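(* Let $p(z)$ be a polynomial with complex coefficients and let $N\geq 3$ be a prime number. Then there exists a non-constant entire function $f(z)$ such that $f\circ p\in C$ if and only if $p(z)-p(0)\in C$.
   Context: Let $\omega$ be a primitive $N$th root of unity. For $k=0,\ldots,N-1$, $C_k$ is the set of functions $f$ analytic at $0$ such that $f(\omega z)=\omega^{k}f(z)$ (equivalently, $f(z)=z^{k}\sum_{j=0}^{\infty}a_jz^{jN}$ near $0$), and $C=\bigcup_{k=0}^{N-1}C_k$ is the set of functions that are cyclic mod $N$. The zero function belongs to every $C_k$. *)

theory Defs
  imports
    "HOL-Complex_Analysis.Complex_Analysis"
    "HOL-Computational_Algebra.Computational_Algebra"
begin

definition primitive_root_of_unity :: "nat \<Rightarrow> complex \<Rightarrow> bool" where
  "primitive_root_of_unity N \<omega> \<longleftrightarrow> N > 0 \<and> \<omega> ^ N = 1 \<and> (\<forall>m. 0 < m \<and> m < N \<longrightarrow> \<omega> ^ m \<noteq> 1)"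

(* The functions in question are only required to be analytic at 0, and HOL functions are total,
   so the functional equation is imposed on a neighbourhood of 0 only. *)
definition cyclic_class :: "complex \<Rightarrow> nat \<Rightarrow> (complex \<Rightarrow> complex) set" where
  "cyclic_class \<omega> k =
     {f. f analytic_on {0} \<and> (\<forall>\<^sub>F z in nhds 0. f (\<omega> * z) = \<omega> ^ k * f z)}"

definition cyclic_functions :: "nat \<Rightarrow> complex \<Rightarrow> (complex \<Rightarrow> complex) set" where
  "cyclic_functions N \<omega> = (\<Union>k<N. cyclic_class \<omega> k)"

end

theory Submission
  imports Defs
begin

text \<open>
  Replacing \<open>f\<close> by \<open>f ^ N\<close>, assume that \<open>F = f \<circ> p\<close> is invariant under \<open>z \<mapsto> \<omega> z\<close>. Write
  \<open>p (\<omega> z) = \<omega> ^ d p z + R z\<close> with \<open>d = degree p\<close> and suppose that \<open>e = degree R\<close> is positive; then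
  \<open>\<omega> ^ n \<noteq> 1\<close> for \<open>n = d - e\<close>. For large \<open>z\<close> the equation \<open>p w = p z\<close> has a root
  \<open>w\<close> close to \<open>\<epsilon> z\<close>, where \<open>\<epsilon> ^ d = 1 \<noteq> \<epsilon> ^ e\<close>, and
  \<open>p (\<omega> w) - p (\<omega> z) = R w - R z\<close> is of exact order \<open>z ^ e\<close>. Hence \<open>p v = p (\<omega> w)\<close> has a root
  \<open>v = \<omega> z (1 + z ^ -n t)\<close> with \<open>t\<close> close to a constant \<open>t0 \<noteq> 0\<close>, and \<open>F v = F z\<close>. Rotating \<open>z\<close> by
  powers of \<open>\<omega>\<close> does not change \<open>F z\<close> but turns \<open>t0 z ^ -n\<close> by powers of \<open>\<omega> ^ n\<close>, a root of unity
  of odd order greater than 1, so one may arrange that \<open>\<bar>v\<bar> < \<bar>z\<bar>\<close>. Taking for \<open>z\<close> a point where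
  \<open>\<bar>F\<bar>\<close> is maximal on a large disc contradicts the maximum modulus principle. So \<open>R\<close> is constant,
  and evaluating at 0 gives \<open>p (\<omega> z) - p 0 = \<omega> ^ d (p z - p 0)\<close>.
\<close>

section \<open>Persistence of isolated zeros under perturbation\<close>

text \<open>On a small circle about \<open>t0\<close> the modulus of \<open>\<Phi> x0\<close>
  exceeds its value 0 at the centre. By compactness of the circle, the same comparison with the
  centre holds for all \<open>x\<close> near \<open>x0\<close>, and the minimum modulus principle
  gives a zero inside.\<close>

lemma zero_near_isolated_zero:
  fixes \<Phi> :: "'a::topological_space \<Rightarrow> complex \<Rightarrow> complex"
  assumes cont: "continuous_on UNIV (\<lambda>(x, t). \<Phi> x t)"
    and hol: "\<And>x. \<Phi> x holomorphic_on UNIV"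
    and zero: "\<Phi> x0 t0 = 0"
    and isol: "\<forall>\<^sub>F t in at t0. \<Phi> x0 t \<noteq> 0"
    and "\<delta> > 0"
  shows "\<forall>\<^sub>F x in nhds x0. \<exists>t\<in>ball t0 \<delta>. \<Phi> x t = 0"
proof -
  obtain d where d: "d > 0" "\<And>t. t \<noteq> t0 \<Longrightarrow> dist t t0 < d \<Longrightarrow> \<Phi> x0 t \<noteq> 0"
    using isol unfolding eventually_at by auto
  define r where "r = min \<delta> (d / 2)"
  have r: "0 < r" "r \<le> \<delta>" "r < d" using d \<open>\<delta> > 0\<close> by (auto simp: r_def)
  define W where "W = {y. norm (\<Phi> (fst y) t0) < norm (\<Phi> (fst y) (snd y))}"
  have c2: "continuous_on UNIV (\<lambda>y. \<Phi> (fst y) (g y))" if "continuous_on UNIV g" for g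
    using continuous_on_compose2[OF cont, of UNIV "\<lambda>y. (fst y, g y)"] that
    by (simp add: continuous_on_Pair continuous_on_fst)
  have "open W"
    unfolding W_def by (intro open_Collect_less continuous_on_norm c2 continuous_intros)
  moreover have "{x0} \<times> sphere t0 r \<subseteq> W"
    using d r zero by (auto simp: W_def dist_commute)
  ultimately obtain X0 where X0: "x0 \<in> X0" "open X0" "X0 \<times> sphere t0 r \<subseteq> W"
    using Elementary_Topology.tube_lemma[OF compact_sphere, of W x0 t0 r] by auto
  have "\<exists>t\<in>ball t0 \<delta>. \<Phi> x t = 0" if "x \<in> X0" for x
  proof -
    have "norm (\<Phi> x t0) < norm (\<Phi> x t)" if "norm (t0 - t) = r" for t
    proof -
      have "(x, t) \<in> W" using X0(3) \<open>x \<in> X0\<close> that by (auto simp: dist_norm)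
      then show ?thesis by (simp add: W_def)
    qed
    moreover have "\<Phi> x holomorphic_on A" for A
      using hol by (rule holomorphic_on_subset) simp
    ultimately obtain t where "t \<in> ball t0 r" "\<Phi> x t = 0"
      using holomorphic_contract_to_zero[of t0 r "\<Phi> x"] r holomorphic_on_imp_continuous_on by metis
    then show ?thesis using r by (intro bexI[of _ t]) auto
  qed
  then show ?thesis
    unfolding eventually_nhds using X0 by blast
qed

section \<open>Polynomials near infinity\<close>

text \<open>
  Substituting \<open>\<zeta> = 1 / z\<close> turns asymptotics as \<open>z\<close> tends to infinity into continuity at \<open>\<zeta> = 0\<close>.
\<close>

definition homogenization :: "complex poly \<Rightarrow> complex \<Rightarrow> complex \<Rightarrow> complex" where
  "homogenization p \<zeta> u = (\<Sum>i\<le>degree p. coeff p i * \<zeta> ^ (degree p - i) * u ^ i)"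

lemma homogenization_eq:
  assumes "\<zeta> \<noteq> 0"
  shows "homogenization p \<zeta> u = \<zeta> ^ degree p * poly p (u / \<zeta>)"
  unfolding homogenization_def poly_altdef sum_distrib_left
  by (intro sum.cong) (auto simp: assms power_diff power_divide)

lemma homogenization_0: "homogenization p 0 u = lead_coeff p * u ^ degree p"
proof -
  have "homogenization p 0 u = (\<Sum>i\<le>degree p. if i = degree p then lead_coeff p * u ^ degree p else 0)"
    unfolding homogenization_def by (intro sum.cong) auto
  then show ?thesis by simp
qed

lemma continuous_on_homogenization [continuous_intros]:
  assumes "continuous_on A f" "continuous_on A g"
  shows "continuous_on A (\<lambda>x. homogenization p (f x) (g x))"
  unfolding homogenization_def using assms by (intro continuous_intros)

lemma holomorphic_on_homogenization [holomorphic_intros]: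
  assumes "f holomorphic_on A" "g holomorphic_on A"
  shows "(\<lambda>x. homogenization p (f x) (g x)) holomorphic_on A"
  unfolding homogenization_def using assms by (intro holomorphic_intros)

text \<open>
  The difference quotient in \<open>homogeneous_quotient_eq\<close> below, with the division by \<open>\<zeta> ^ n\<close> carried
  out symbolically so that it extends continuously to \<open>\<zeta> = 0\<close>.
\<close>

definition homogeneous_quotient ::
    "complex poly \<Rightarrow> complex \<Rightarrow> nat \<Rightarrow> complex \<Rightarrow> complex \<Rightarrow> complex" where
  "homogeneous_quotient p a n \<zeta> t =
     (\<Sum>i\<le>degree p. coeff p i * \<zeta> ^ (degree p - i) * a ^ i * (t * (\<Sum>j<i. (1 + \<zeta> ^ n * t) ^ j)))"

lemma homogeneous_quotient_eq:
  "\<zeta> ^ n * homogeneous_quotient p a n \<zeta> t =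
     homogenization p \<zeta> (a * (1 + \<zeta> ^ n * t)) - homogenization p \<zeta> a"
proof -
  have *: "(1 + \<zeta> ^ n * t) ^ i = 1 + \<zeta> ^ n * t * (\<Sum>j<i. (1 + \<zeta> ^ n * t) ^ j)" for i
    using power_diff_1_eq[of "1 + \<zeta> ^ n * t" i] by (simp add: algebra_simps)
  show ?thesis
    unfolding homogeneous_quotient_def homogenization_def sum_distrib_left sum_subtractf[symmetric]
    unfolding power_mult_distrib
    by (intro sum.cong refl, subst *)
       (simp add: distrib_left mult_ac flip: sum_distrib_left)
qed

lemma homogeneous_quotient_0:
  assumes "n > 0"
  shows "homogeneous_quotient p a n 0 t = lead_coeff p * a ^ degree p * (of_nat (degree p) * t)"
proof -
  have "homogeneous_quotient p a n 0 t = (\<Sum>i\<le>degree p. if i = degree p then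
           lead_coeff p * a ^ degree p * (of_nat (degree p) * t) else 0)"
    unfolding homogeneous_quotient_def using assms
    by (intro sum.cong) (auto simp: power_0_left)
  then show ?thesis by simp
qed

lemma continuous_on_homogeneous_quotient [continuous_intros]:
  assumes "continuous_on A f" "continuous_on A g"
  shows "continuous_on A (\<lambda>x. homogeneous_quotient p a n (f x) (g x))"
  unfolding homogeneous_quotient_def using assms by (intro continuous_intros)

lemma holomorphic_on_homogeneous_quotient [holomorphic_intros]:
  assumes "f holomorphic_on A" "g holomorphic_on A"
  shows "(\<lambda>x. homogeneous_quotient p a n (f x) (g x)) holomorphic_on A"
  unfolding homogeneous_quotient_def using assms by (intro holomorphic_intros)

section \<open>Solving the perturbed equations near infinity\<close>

lemma exists_root_of_unity_power_neq_1:
  assumes "0 < e" "e < d"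
  obtains \<epsilon> :: complex where "\<epsilon> ^ d = 1" "\<epsilon> ^ e \<noteq> 1"
proof
  show "exp (2 * of_real pi * \<i> * of_nat 1 / of_nat d) ^ d = 1"
    using assms by (intro complex_root_unity) auto
  have "exp (2 * of_real pi * \<i> * of_nat 1 / of_nat d) ^ e = exp (2 * of_real pi * \<i> * of_nat e / of_nat d)"
    by (simp add: mult_ac flip: exp_of_nat_mult)
  then show "exp (2 * of_real pi * \<i> * of_nat 1 / of_nat d) ^ e \<noteq> 1"
    using assms complex_root_unity_eq_1[of d e] by (auto dest: dvd_imp_le)
qed

lemma perturbed_rotation:
  fixes p R :: "complex poly" and a c :: complex
  assumes R: "\<And>z. poly p (a * z) = c * poly p z + poly R z"
    and a: "a \<noteq> 0"
    and deg: "0 < degree R" "degree R < degree p"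
  defines "n \<equiv> degree p - degree R"
  obtains t0 where "t0 \<noteq> 0"
    "\<And>\<delta>. \<delta> > 0 \<Longrightarrow> \<forall>\<^sub>F \<zeta> in at 0. \<exists>t\<in>ball t0 \<delta>. \<exists>w.
        poly p w = poly p (1 / \<zeta>) \<and> poly p (a / \<zeta> * (1 + \<zeta> ^ n * t)) = poly p (a * w)"
proof -
  obtain \<epsilon> :: complex where \<epsilon>: "\<epsilon> ^ degree p = 1" "\<epsilon> ^ degree R \<noteq> 1"
    using exists_root_of_unity_power_neq_1 deg by blast
  have n: "n > 0" "degree p = n + degree R" using deg by (auto simp: n_def)
  have p0: "lead_coeff p \<noteq> 0" "lead_coeff R \<noteq> 0" using deg by auto
  \<comment> \<open>At \<open>\<zeta> = 0\<close> the equation for \<open>t\<close> degenerates to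
    the linear equation \<open>A * t = B\<close>.\<close>
  define A where "A = lead_coeff p * a ^ degree p * of_nat (degree p)"
  define B where "B = lead_coeff R * (\<epsilon> ^ degree R - 1)"
  have AB: "A \<noteq> 0" "B \<noteq> 0" using p0 a \<epsilon> deg by (auto simp: A_def B_def)
  define t0 where "t0 = B / A"
  \<comment> \<open>For \<open>x = (\<zeta>, u)\<close> with \<open>\<zeta> \<noteq> 0\<close> this
    is \<open>\<zeta> ^ degree R\<close> times the difference between \<open>poly p (a / \<zeta> *
    (1 + \<zeta> ^ n * t)) - poly p (a / \<zeta>)\<close> and
    \<open>poly R (u / \<zeta>) - poly R (1 / \<zeta>)\<close>.\<close>
  define \<Phi> where "\<Phi> x t = homogeneous_quotient p a n (fst x) t
      - (homogenization R (fst x) (snd x) - homogenization R (fst x) 1)" for x t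
  have \<Phi>0: "\<Phi> (0, \<epsilon>) t = A * t - B" for t
    using n by (simp add: \<Phi>_def homogeneous_quotient_0 homogenization_0 A_def B_def algebra_simps)
  show thesis
  proof
    show "t0 \<noteq> 0" using AB by (simp add: t0_def)
    fix \<delta> :: real assume "\<delta> > 0"
    have "\<forall>\<^sub>F x in nhds (0, \<epsilon>). \<exists>t\<in>ball t0 \<delta>. \<Phi> x t = 0"
    proof (rule zero_near_isolated_zero)
      show "continuous_on UNIV (\<lambda>(x, t). \<Phi> x t)"
        unfolding \<Phi>_def case_prod_beta by (intro continuous_intros)
      show "\<Phi> x holomorphic_on UNIV" for x
        unfolding \<Phi>_def by (intro holomorphic_intros)
      show "\<Phi> (0, \<epsilon>) t0 = 0" using AB by (simp add: \<Phi>0 t0_def)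
      show "\<forall>\<^sub>F t in at t0. \<Phi> (0, \<epsilon>) t \<noteq> 0"
        using AB by (auto simp: \<Phi>0 t0_def eventually_at field_simps intro!: exI[of _ 1])
    qed fact
    \<comment> \<open>Separating the conditions on \<open>\<zeta>\<close> and \<open>u\<close> fixes
      the radius \<open>\<delta>'\<close> for \<open>u\<close> before \<open>\<zeta>\<close> is
      chosen.\<close>
    then obtain P Q where PQ: "eventually P (nhds 0)" "eventually Q (nhds \<epsilon>)"
       "\<And>x y. P x \<Longrightarrow> Q y \<Longrightarrow> \<exists>t\<in>ball t0 \<delta>. \<Phi> (x, y) t = 0"
      unfolding nhds_prod eventually_prod_filter by auto
    obtain \<delta>' where \<delta>': "\<delta>' > 0" "\<And>u. dist u \<epsilon> < \<delta>' \<Longrightarrow> Q u"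
      using PQ(2) unfolding eventually_nhds_metric by auto
    \<comment> \<open>For \<open>\<zeta> \<noteq> 0\<close>, a zero \<open>u\<close> yields
      \<open>w = u / \<zeta>\<close> with \<open>poly p w = poly p (1 / \<zeta>)\<close>.\<close>
    define \<Psi> where "\<Psi> \<zeta> u = homogenization p \<zeta> u - homogenization p \<zeta> 1" for \<zeta> u
    have "\<forall>\<^sub>F \<zeta> in nhds 0. \<exists>u\<in>ball \<epsilon> \<delta>'. \<Psi> \<zeta> u = 0"
    proof (rule zero_near_isolated_zero)
      show "continuous_on UNIV (\<lambda>(x, t). \<Psi> x t)"
        unfolding \<Psi>_def case_prod_beta by (intro continuous_intros)
      show "\<Psi> x holomorphic_on UNIV" for x
        unfolding \<Psi>_def by (intro holomorphic_intros)
      show "\<Psi> 0 \<epsilon> = 0" using \<epsilon> by (simp add: \<Psi>_def homogenization_0)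
      have "finite {u::complex. u ^ degree p = 1}"
        using deg by (intro finite_roots_unity) auto
      then have "\<not> \<epsilon> islimpt {u. u ^ degree p = 1}"
        by (rule islimpt_finite)
      then show "\<forall>\<^sub>F u in at \<epsilon>. \<Psi> 0 u \<noteq> 0"
        using p0 by (simp add: islimpt_iff_eventually \<Psi>_def homogenization_0)
    qed fact
    then have "\<forall>\<^sub>F \<zeta> in at 0. \<zeta> \<noteq> 0 \<and> P \<zeta> \<and> (\<exists>u\<in>ball \<epsilon> \<delta>'. \<Psi> \<zeta> u = 0)"
      using PQ(1) by (auto simp: eventually_at_filter elim: eventually_elim2)
    then show "\<forall>\<^sub>F \<zeta> in at 0. \<exists>t\<in>ball t0 \<delta>. \<exists>w.
        poly p w = poly p (1 / \<zeta>) \<and> poly p (a / \<zeta> * (1 + \<zeta> ^ n * t)) = poly p (a * w)"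
    proof eventually_elim
      case (elim \<zeta>)
      then obtain u where u: "u \<in> ball \<epsilon> \<delta>'" "\<Psi> \<zeta> u = 0" by blast
      with \<delta>' have "Q u" by (auto simp: dist_commute)
      with PQ elim obtain t where t: "t \<in> ball t0 \<delta>" "\<Phi> (\<zeta>, u) t = 0" by blast
      have w: "poly p (u / \<zeta>) = poly p (1 / \<zeta>)"
        using u elim by (simp add: \<Psi>_def homogenization_eq)
      have "\<zeta> ^ n * homogeneous_quotient p a n \<zeta> t =
            \<zeta> ^ n * (homogenization R \<zeta> u - homogenization R \<zeta> 1)"
        using t by (simp add: \<Phi>_def)
      then have "\<zeta> ^ degree p * (poly p (a * (1 + \<zeta> ^ n * t) / \<zeta>) - poly p (a / \<zeta>)) =
            \<zeta> ^ degree p * (poly R (u / \<zeta>) - poly R (1 / \<zeta>))"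
        using elim unfolding homogeneous_quotient_eq
        by (simp add: homogenization_eq n(2) power_add algebra_simps)
      then have "poly p (a * (1 + \<zeta> ^ n * t) / \<zeta>) =
          poly p (a / \<zeta>) + (poly R (u / \<zeta>) - poly R (1 / \<zeta>))"
        using elim by (simp only: mult_cancel_left power_eq_0_iff) (auto simp: algebra_simps)
      \<comment> \<open>Expanding by \<open>R\<close> at \<open>u / \<zeta>\<close> and
        \<open>1 / \<zeta>\<close>, the terms with factor \<open>c\<close> agree by
        \<open>w\<close>.\<close>
      also have "\<dots> = poly p (a * (u / \<zeta>))"
        using R[of "u / \<zeta>"] R[of "1 / \<zeta>"] w by simp
      finally show ?case using w t by (intro bexI[of _ t] exI[of _ "u / \<zeta>"]) auto
    qed
  qed
qed

section \<open>Rotations and moduli\<close>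

lemma norm_eq_1_if_power_eq_1:
  fixes x :: complex
  assumes "x ^ n = 1" "n > 0"
  shows "norm x = 1"
  using power_eq_imp_eq_base[of "norm x" n 1] assms by (simp flip: norm_power)

text \<open>Since \<open>\<eta> ^ 2 \<noteq> 1\<close>, the powers of \<open>\<eta>\<close> and
  those of \<open>\<eta> ^ 2\<close> both sum to 0, which fixes the first two moments of the real
  parts. Any positive constant below 1/4 could replace 1/5.\<close>

lemma exists_rotation_Re_le:
  fixes \<eta> c :: complex
  assumes "\<eta> ^ N = 1" "\<eta> ^ 2 \<noteq> 1" "N > 0"
  obtains j where "Re (c * \<eta> ^ j) \<le> - norm c / 5"
proof (rule ccontr)
  assume "\<not> thesis"
  then have *: "Re (c * \<eta> ^ j) > - norm c / 5" for j using that by (meson not_le)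
  from *[of 0] have "c \<noteq> 0" by auto
  have norm1: "norm \<eta> = 1"
    using assms(1,3) by (rule norm_eq_1_if_power_eq_1)
  have sum0: "(\<Sum>j<N. x ^ j) = 0" if "x ^ N = 1" "x \<noteq> 1" for x :: complex
    using geometric_sum[of x N] that by simp
  have "\<eta> \<noteq> 1" using assms by auto
  then have "(\<Sum>j<N. c * \<eta> ^ j) = 0"
    using sum0[of \<eta>] assms(1) by (simp flip: sum_distrib_left)
  then have S1: "(\<Sum>j<N. Re (c * \<eta> ^ j)) = 0" by (metis Re_sum zero_complex.sel(1))
  have "(\<eta>\<^sup>2) ^ N = 1" using assms(1) by (metis power_mult mult.commute power_one)
  then have "(\<Sum>j<N. (c * \<eta> ^ j)\<^sup>2) = 0"
    using sum0[of "\<eta>\<^sup>2"] assms(2)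
    by (simp add: power_mult_distrib flip: sum_distrib_left power_mult) (simp add: mult.commute power_mult)
  then have S2: "(\<Sum>j<N. Re ((c * \<eta> ^ j)\<^sup>2)) = 0" by (metis Re_sum zero_complex.sel(1))
  \<comment> \<open>The numbers \<open>Re (c * \<eta> ^ j)\<close> have mean 0 but mean square \<open>(norm c)\<^sup>2 / 2\<close>, so they cannot all
    be close to nonnegative.\<close>
  have Re_sq: "(Re x)\<^sup>2 = ((norm x)\<^sup>2 + Re (x\<^sup>2)) / 2" for x
    by (simp add: cmod_power2 Re_power2)
  have "(\<Sum>j<N. (Re (c * \<eta> ^ j))\<^sup>2) = N * (norm c)\<^sup>2 / 2"
    unfolding Re_sq using S2 norm1
    by (simp add: sum.distrib norm_mult norm_power flip: sum_divide_distrib)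
  moreover have "(\<Sum>j<N. (Re (c * \<eta> ^ j))\<^sup>2) \<le> (\<Sum>j<N. norm c * (Re (c * \<eta> ^ j) + 2 / 5 * norm c))"
  proof (rule sum_mono)
    fix j
    let ?X = "Re (c * \<eta> ^ j)"
    have "\<bar>?X\<bar> \<le> norm c"
      using abs_Re_le_cmod[of "c * \<eta> ^ j"] norm1 by (simp add: norm_mult norm_power)
    \<comment> \<open>A negative \<open>?X\<close> exceeds \<open>- norm c / 5\<close>, so
      \<open>- ?X\<close> is at most \<open>?X + 2 / 5 * norm c\<close>. After summation the
      contradiction is 1/2 \<le> 2/5.\<close>
    moreover have "\<bar>?X\<bar> \<le> ?X + 2 / 5 * norm c"
      using *[of j] by (cases "?X \<ge> 0") auto
    ultimately have "\<bar>?X\<bar> * \<bar>?X\<bar> \<le> norm c * (?X + 2 / 5 * norm c)"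
      by (intro mult_mono) auto
    then show "?X\<^sup>2 \<le> norm c * (?X + 2 / 5 * norm c)"
      by (simp add: power2_eq_square)
  qed
  moreover have "(\<Sum>j<N. norm c * (Re (c * \<eta> ^ j) + 2 / 5 * norm c)) = 2 / 5 * (N * (norm c)\<^sup>2)"
    using S1 by (simp add: sum.distrib power2_eq_square flip: sum_distrib_left)
  ultimately have "N * (norm c)\<^sup>2 \<le> 0" by simp
  then show False using \<open>c \<noteq> 0\<close> \<open>N > 0\<close> by (simp add: mult_le_0_iff)
qed

text \<open>Let \<open>y\<close> maximize the modulus of \<open>F\<close> on the closed disc. An
  interior point with the same value would be a maximum too and force constancy; the case
  \<open>v = y\<close> puts \<open>y\<close> on the circle.\<close>

lemma nonconstant_entire_max_on_circle:
  assumes hol: "F holomorphic_on UNIV" and nc: "\<not> F constant_on UNIV" and "r > 0"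
  obtains y where "norm y = r" "\<And>v. norm v < r \<Longrightarrow> F v \<noteq> F y"
proof -
  have "continuous_on (cball 0 r) (\<lambda>x. norm (F x))"
    using hol by (intro continuous_on_norm holomorphic_on_imp_continuous_on) (blast intro: holomorphic_on_subset)
  then obtain y where y: "y \<in> cball 0 r" "\<And>x. x \<in> cball 0 r \<Longrightarrow> norm (F x) \<le> norm (F y)"
    using continuous_attains_sup[of "cball 0 r" "\<lambda>x. norm (F x)"] \<open>r > 0\<close> by auto
  have "F v \<noteq> F y" if "norm v < r" for v
  proof
    assume "F v = F y"
    then have "F constant_on UNIV"
      using y that by (intro maximum_modulus_principle[OF hol, of "ball 0 r" v]) auto
    then show False using nc by blast
  qed
  then show thesis using y(1) that by (metis mem_cball_0 order_le_less)
qed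

text \<open>With \<open>m = norm s * norm t0\<close>, one has
  \<open>Re (s * t) \<le> - m / 10\<close> and \<open>norm (s * t) \<le> 11 / 10 * m\<close>. In the
  square of \<open>norm (1 + s * t)\<close> the linear gain \<open>m / 5\<close> beats the quadratic
  term because \<open>m < 1 / 10\<close>.\<close>

lemma norm_one_plus_less_1:
  fixes t t0 s :: complex
  assumes "t \<in> ball t0 (norm t0 / 10)" "Re (t0 * s) \<le> - norm (t0 * s) / 5"
    and "s \<noteq> 0" "norm s * norm t0 < 1 / 10"
  shows "norm (1 + s * t) < 1"
proof -
  define m where "m = norm s * norm t0"
  have "norm (t - t0) < norm t0 / 10"
    using assms(1) by (simp add: dist_norm norm_minus_commute)
  then have d: "norm (s * (t - t0)) \<le> m / 10" "norm t0 > 0"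
    using mult_left_mono[of "norm (t - t0)" "norm t0 / 10" "norm s"]
    by (auto simp: norm_mult m_def intro: le_less_trans[OF norm_ge_zero])
  have m: "0 < m" "m < 1 / 10" using assms d by (auto simp: m_def)
  have eq: "s * t = t0 * s + s * (t - t0)" by (simp add: algebra_simps)
  have "norm (t0 * s) = m" by (simp add: m_def norm_mult)
  then have "norm (s * t) \<le> m + m / 10"
    unfolding eq using d norm_triangle_le by (metis add_left_mono)
  then have n2: "(norm (s * t))\<^sup>2 \<le> (11 / 10 * m)\<^sup>2" by (intro power_mono) auto
  have Re: "Re (s * t) \<le> - m / 10"
    using assms(2) \<open>norm (t0 * s) = m\<close> d complex_Re_le_cmod[of "s * (t - t0)"] unfolding eq by simp
  have "(norm (1 + s * t))\<^sup>2 = 1 + 2 * Re (s * t) + (norm (s * t))\<^sup>2"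
    unfolding cmod_power2 by (simp add: power2_eq_square algebra_simps)
  also have "\<dots> \<le> 1 - m / 5 + 121 / 100 * m * m" using n2 Re by (simp add: power2_eq_square)
  also have "\<dots> < 1"
  proof -
    have "m * m < m * (1 / 10)" using m by (intro mult_strict_left_mono) auto
    then show ?thesis using m by simp
  qed
  finally show ?thesis by (simp add: abs_square_less_1)
qed

section \<open>Compositions invariant under the rotation\<close>

lemma rotation_invariant_composition:
  fixes p :: "complex poly" and \<omega> :: complex
  assumes f: "f holomorphic_on UNIV" "\<not> f constant_on UNIV"
    and \<omega>: "\<omega> ^ N = 1" "odd N"
    and inv: "\<And>z. f (poly p (\<omega> * z)) = f (poly p z)"
  obtains c where "\<And>z. poly p (\<omega> * z) = \<omega> ^ degree p * poly p z + c"
proof (cases "degree p = 0")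
  case True
  then obtain a where "p = [:a:]" by (rule degree_eq_zeroE)
  then show thesis using that[of 0] by simp
next
  case False
  define R where "R = pcompose p [:0, \<omega>:] - smult (\<omega> ^ degree p) p"
  have R: "poly p (\<omega> * z) = \<omega> ^ degree p * poly p z + poly R z" for z
    by (simp add: R_def poly_pcompose algebra_simps)
  have "N > 0" using \<omega> by (auto intro: Nat.gr0I)
  have "\<omega> \<noteq> 0" using \<omega> by (auto simp: power_0_left split: if_splits)
  have n\<omega>: "norm \<omega> = 1" using \<omega>(1) \<open>N > 0\<close>
    by (rule norm_eq_1_if_power_eq_1)
  \<comment> \<open>The factor vanishes at \<open>i = degree p\<close>, so a nonconstant
    \<open>R\<close> has smaller degree than \<open>p\<close>.\<close>
  have coeff_R: "coeff R i = (\<omega> ^ i - \<omega> ^ degree p) * coeff p i" for i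
    by (simp add: R_def coeff_pcompose_linear algebra_simps)
  have "degree R = 0"
  proof (rule ccontr)
    assume "degree R \<noteq> 0"
    then have "lead_coeff R \<noteq> 0" by auto
    then have *: "\<omega> ^ degree R \<noteq> \<omega> ^ degree p" "coeff p (degree R) \<noteq> 0" by (auto simp: coeff_R)
    then have "degree R \<le> degree p" "degree R \<noteq> degree p" by (auto intro: le_degree)
    then have less: "degree R < degree p" by simp
    define n where "n = degree p - degree R"
    define \<eta> where "\<eta> = \<omega> ^ n"
    have "n > 0" using less by (simp add: n_def)
    have "\<eta> \<noteq> 1"
    proof
      assume "\<eta> = 1"
      then have "\<omega> ^ (degree R + n) = \<omega> ^ degree R" by (simp add: \<eta>_def power_add)
      then show False using * less by (simp add: n_def)
    qed
    have "\<eta> ^ N = 1" unfolding \<eta>_def using \<omega>(1) by (metis power_mult mult.commute power_one)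
    have "\<eta>\<^sup>2 \<noteq> 1"
    proof
      assume "\<eta>\<^sup>2 = 1"
      obtain k where "N = 2 * k + 1" using \<omega>(2) by (auto elim: oddE)
      then have "\<eta> ^ N = \<eta>" using \<open>\<eta>\<^sup>2 = 1\<close> by (simp add: power_mult)
      then show False using \<open>\<eta> ^ N = 1\<close> \<open>\<eta> \<noteq> 1\<close> by simp
    qed
    obtain t0 where t0: "t0 \<noteq> 0"
      "\<And>\<delta>. \<delta> > 0 \<Longrightarrow> \<forall>\<^sub>F \<zeta> in at 0. \<exists>t\<in>ball t0 \<delta>. \<exists>w.
          poly p w = poly p (1 / \<zeta>) \<and> poly p (\<omega> / \<zeta> * (1 + \<zeta> ^ n * t)) = poly p (\<omega> * w)"
      using perturbed_rotation[OF R \<open>\<omega> \<noteq> 0\<close> _ less] \<open>degree R \<noteq> 0\<close> unfolding n_def by blast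
    have "((\<lambda>\<zeta>::complex. norm (\<zeta> ^ n) * norm t0) \<longlongrightarrow> norm ((0::complex) ^ n) * norm t0) (at 0)"
      by (intro tendsto_intros)
    then have "\<forall>\<^sub>F \<zeta>::complex in at 0. norm (\<zeta> ^ n) * norm t0 < 1 / 10"
      by (rule order_tendstoD(2)) (use \<open>n > 0\<close> in \<open>simp add: power_0_left\<close>)
    then have "\<forall>\<^sub>F \<zeta> in at 0. norm (\<zeta> ^ n) * norm t0 < 1 / 10 \<and>
       (\<exists>t\<in>ball t0 (norm t0 / 10). \<exists>w.
          poly p w = poly p (1 / \<zeta>) \<and> poly p (\<omega> / \<zeta> * (1 + \<zeta> ^ n * t)) = poly p (\<omega> * w))"
      using t0(1) by (intro eventually_conj t0(2)) auto
    then obtain \<rho> where \<rho>: "\<rho> > 0"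
      "\<And>\<zeta>. \<zeta> \<noteq> 0 \<Longrightarrow> norm \<zeta> < \<rho> \<Longrightarrow> norm (\<zeta> ^ n) * norm t0 < 1 / 10 \<and>
       (\<exists>t\<in>ball t0 (norm t0 / 10). \<exists>w.
          poly p w = poly p (1 / \<zeta>) \<and> poly p (\<omega> / \<zeta> * (1 + \<zeta> ^ n * t)) = poly p (\<omega> * w))"
      unfolding eventually_at by auto
    define F where "F z = f (poly p z)" for z
    have F_inv: "F (\<omega> * z) = F z" for z using inv by (simp add: F_def)
    have F_hol: "F holomorphic_on UNIV"
      unfolding F_def using f(1)
      by (intro holomorphic_on_compose_gen[of "poly p" _ f UNIV, unfolded o_def] holomorphic_intros) auto
    have "surj (poly p)"
      unfolding surj_def
    proof
      fix w
      have "degree (p + [:- w:]) = degree p" using False by (intro degree_add_eq_left) auto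
      then have "\<not> constant (poly (p + [:- w:]))" using False by (simp add: constant_degree)
      then have "\<exists>z. poly (p + [:- w:]) z = 0"
        by (rule Fundamental_Theorem_Algebra.fundamental_theorem_of_algebra)
      then show "\<exists>z. w = poly p z" by auto
    qed
    then have F_nc: "\<not> F constant_on UNIV"
      using f(2) unfolding F_def constant_on_def by (metis surjD UNIV_I)
    \<comment> \<open>The radius \<open>2 / \<rho>\<close> puts \<open>1 / y\<close> and its
      rotations at distance \<open>\<rho> / 2\<close> from 0, where the conditions of
      \<open>\<rho>\<close> apply.\<close>
    obtain y where y: "norm y = 2 / \<rho>" "\<And>v. norm v < 2 / \<rho> \<Longrightarrow> F v \<noteq> F y"
      using nonconstant_entire_max_on_circle[OF F_hol F_nc, of "2 / \<rho>"] \<rho>(1) by auto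
    have "y \<noteq> 0" using y \<rho> by auto
    obtain j where j: "Re (t0 / y ^ n * \<eta> ^ j) \<le> - norm (t0 / y ^ n) / 5"
      using exists_rotation_Re_le[OF \<open>\<eta> ^ N = 1\<close> \<open>\<eta>\<^sup>2 \<noteq> 1\<close> \<open>N > 0\<close>] by metis
    \<comment> \<open>\<open>1 / \<zeta>\<close> is a rotation of \<open>y\<close>, so
      \<open>F\<close> keeps its value there, while \<open>t0 * \<zeta> ^ n\<close> is turned into
      the left half-plane.\<close>
    define \<zeta> where "\<zeta> = \<omega> ^ j / y"
    have \<zeta>: "\<zeta> \<noteq> 0" "norm \<zeta> = \<rho> / 2"
      using \<open>y \<noteq> 0\<close> \<open>\<omega> \<noteq> 0\<close> y n\<omega> by (auto simp: \<zeta>_def norm_divide norm_power)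
    have F_pow: "F (\<omega> ^ i * z) = F z" for i z
      by (induction i) (simp_all add: F_inv mult.assoc)
    have F\<zeta>: "F (1 / \<zeta>) = F y"
      using F_pow[of j "1 / \<zeta>"] \<open>\<omega> \<noteq> 0\<close> by (simp add: \<zeta>_def)
    obtain t w where tw: "t \<in> ball t0 (norm t0 / 10)" "poly p w = poly p (1 / \<zeta>)"
        "poly p (\<omega> / \<zeta> * (1 + \<zeta> ^ n * t)) = poly p (\<omega> * w)" "norm (\<zeta> ^ n) * norm t0 < 1 / 10"
      using \<rho>(2)[of \<zeta>] \<rho>(1) \<zeta> by auto
    define v where "v = \<omega> / \<zeta> * (1 + \<zeta> ^ n * t)"
    \<comment> \<open>The chain is
      \<open>F v = F (\<omega> * w) = F w = F (1 / \<zeta>) = F y\<close>.\<close>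
    have "F v = F y" using tw F_inv[of w] F\<zeta> by (simp add: F_def v_def)
    have "t0 * \<zeta> ^ n = t0 / y ^ n * \<eta> ^ j"
      by (simp add: \<zeta>_def \<eta>_def power_divide mult.commute flip: power_mult)
    moreover have "norm (t0 / y ^ n * \<eta> ^ j) = norm (t0 / y ^ n)"
      using n\<omega> by (simp add: norm_mult norm_divide norm_power \<eta>_def)
    ultimately have "norm (1 + \<zeta> ^ n * t) < 1"
      using tw j \<zeta> by (intro norm_one_plus_less_1[of t t0]) auto
    then have "2 / \<rho> * norm (1 + \<zeta> ^ n * t) < 2 / \<rho> * 1"
      using \<rho>(1) by (intro mult_strict_left_mono) auto
    then have "norm v < 2 / \<rho>"
      unfolding v_def norm_mult norm_divide \<zeta>(2) n\<omega> by simp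
    then show False using y(2) \<open>F v = F y\<close> by blast
  qed
  then obtain c where "R = [:c:]" by (rule degree_eq_zeroE)
  then show thesis using R that[of c] by simp
qed

section \<open>Reduction to the invariant case, and the converse\<close>

theorem theorem23:
  fixes p :: "complex poly" and N :: nat and \<omega> :: complex
  assumes "prime N" and "N \<ge> 3"
    and "primitive_root_of_unity N \<omega>"
  shows "(\<exists>f. f holomorphic_on UNIV \<and> \<not> f constant_on UNIV \<and>
              f \<circ> poly p \<in> cyclic_functions N \<omega>)
         \<longleftrightarrow> (\<lambda>z. poly p z - poly p 0) \<in> cyclic_functions N \<omega>"
proof
  assume "\<exists>f. f holomorphic_on UNIV \<and> \<not> f constant_on UNIV \<and> f \<circ> poly p \<in> cyclic_functions N \<omega>"
  then obtain f k where f: "f holomorphic_on UNIV" "\<not> f constant_on UNIV"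
      and cyc: "\<forall>\<^sub>F z in nhds 0. f (poly p (\<omega> * z)) = \<omega> ^ k * f (poly p z)"
    unfolding cyclic_functions_def cyclic_class_def by auto
  have \<omega>: "\<omega> ^ N = 1" "N > 0" using assms(3) by (auto simp: primitive_root_of_unity_def)
  have "odd N" using assms prime_odd_nat by auto
  obtain U where U: "open U" "0 \<in> U" "\<And>z. z \<in> U \<Longrightarrow> f (poly p (\<omega> * z)) = \<omega> ^ k * f (poly p z)"
    using cyc unfolding eventually_nhds by auto
  have hol: "(\<lambda>z. f (poly p (a * z))) holomorphic_on UNIV" for a
    using f(1) by (intro holomorphic_on_compose_gen[of "\<lambda>z. poly p (a * z)" _ f UNIV, unfolded o_def]
        holomorphic_intros) auto
  \<comment> \<open>The identity theorem extends the functional equation from \<open>U\<close> to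
    the whole plane.\<close>
  have all: "f (poly p (\<omega> * z)) = \<omega> ^ k * f (poly p z)" for z
  proof (rule analytic_continuation_open[of U UNIV "\<lambda>z. f (poly p (\<omega> * z))"])
    show "(\<lambda>z. \<omega> ^ k * f (poly p z)) holomorphic_on UNIV"
      using hol[of 1] by (auto intro!: holomorphic_intros)
  qed (use U hol in auto)
  \<comment> \<open>Taking the \<open>N\<close>-th power removes the factor
    \<open>\<omega> ^ k\<close>.\<close>
  define g where "g z = f z ^ N" for z
  have g: "g holomorphic_on UNIV" unfolding g_def by (intro holomorphic_intros f)
  have g_nc: "\<not> g constant_on UNIV"
  proof
    assume "g constant_on UNIV"
    then obtain c where c: "\<And>z. f z ^ N = c" by (auto simp: constant_on_def g_def)
    \<comment> \<open>A continuous function on a connected set with finitely many values is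
      constant.\<close>
    have "finite {u. u ^ N = c}"
      using finite_nth_roots \<omega>(2) by blast
    then have "finite (range f)" using c by (auto elim: finite_subset[rotated])
    then have "f constant_on UNIV"
      using continuous_finite_range_constant[of UNIV f] f(1) holomorphic_on_imp_continuous_on
        connected_UNIV by blast
    then show False using f(2) by blast
  qed
  have "g (poly p (\<omega> * z)) = g (poly p z)" for z
  proof -
    have "(\<omega> ^ k) ^ N = 1" using \<omega>(1) by (metis power_mult mult.commute power_one)
    then show ?thesis by (simp add: g_def all power_mult_distrib)
  qed
  then obtain c where c: "\<And>z. poly p (\<omega> * z) = \<omega> ^ degree p * poly p z + c"
    using rotation_invariant_composition[OF g g_nc \<omega>(1) \<open>odd N\<close>] by metis
  \<comment> \<open>The index of a cyclic class lies below \<open>N\<close>, so the exponent is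
    reduced.\<close>
  have "\<omega> ^ degree p = \<omega> ^ (degree p mod N + N * (degree p div N))" by simp
  also have "\<dots> = \<omega> ^ (degree p mod N)" using \<omega>(1) by (simp only: power_add power_mult) simp
  finally have "poly p (\<omega> * z) - poly p 0 = \<omega> ^ (degree p mod N) * (poly p z - poly p 0)" for z
    using c[of z] c[of 0] by (simp add: algebra_simps)
  then show "(\<lambda>z. poly p z - poly p 0) \<in> cyclic_functions N \<omega>"
    unfolding cyclic_functions_def cyclic_class_def using \<omega>(2)
    by (auto intro!: bexI[of _ "degree p mod N"] analytic_intros
        holomorphic_on_imp_analytic_at[of _ UNIV] holomorphic_intros)
next
  assume "(\<lambda>z. poly p z - poly p 0) \<in> cyclic_functions N \<omega>"
  \<comment> \<open>The witness is the translation by \<open>- poly p 0\<close>.\<close>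
  moreover have "\<not> (\<lambda>z. z - poly p 0) constant_on UNIV"
  proof
    assume "(\<lambda>z. z - poly p 0) constant_on UNIV"
    then obtain c where "\<And>z. z - poly p 0 = c" by (auto simp: constant_on_def)
    from this[of "poly p 0"] this[of "poly p 0 + 1"] show False by simp
  qed
  ultimately show "\<exists>f. f holomorphic_on UNIV \<and> \<not> f constant_on UNIV \<and> f \<circ> poly p \<in> cyclic_functions N \<omega>"
    by (intro exI[of _ "\<lambda>z. z - poly p 0"]) (auto simp: o_def intro!: holomorphic_intros)
qed

end
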